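(* Let $\Omega$ be a nonempty locally compact Hausdorff space and let $f, g\in \mathcal{C}_b(\Omega)$. For $\varepsilon>0$ put $M^\varepsilon_f = \{x\in \Omega : |f(x)| \geq \|f\| - \varepsilon\}$. Then the following statements are equivalent: (i) For every $\varepsilon >0$ there exists a sequence $(\mu_n)$ of probability measures on $\Omega$ concentrated at $M^\varepsilon_f$ such that the limits below exist and $$\|f\|\,\Big|\lim_{n\rightarrow\infty}\int_\Omega \overline{f(x)}\,g(x)\,d\mu_n(x)\Big| = \|g\|\lim_{n\rightarrow\infty}\int_\Omega |f(x)|^2\,d\mu_n(x).$$ (ii) $f\parallel g$, i.e. there is $\lambda\in\mathbb{T}$ with $\|f+\lambda g\| = \|f\|+\|g\|$.
   Context: $\mathbb{T}=\{\lambda\in\mathbb{C}:|\lambda|=1\}$. $\mathcal{C}_b(\Omega)$ is the Banach space of all bounded continuous complex-valued functions on $\Omega$ with norm $\|f\|=\sup_{x\in\Omega}|f(x)|$. In a normed space $X$, an element $x$ is norm-parallel to $y$, written $x\parallel y$, if $\|x+\lambda y\|=\|x\|+\|y\|$ for some $\lambda\in\mathbb{T}$. A probability measure is a positive (Borel) measure of total mass $1$; a measure $\mu$ on $\Omega$ is concentrated at a (closed) set $M\subseteq\Omega$ if $\mu(\Omega\setminus M)=0$. *)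

theory Defs
  imports "HOL-Probability.Probability"
begin

(* The library equips bounded continuous complex functions only with real scalar
   multiplication, whereas norm-parallelism needs unimodular complex scalars. *)
definition scaleC_bcontfun ::
    "complex \<Rightarrow> ('a::topological_space \<Rightarrow>\<^sub>C complex) \<Rightarrow> ('a \<Rightarrow>\<^sub>C complex)" (infixr "*\<^sub>c" 75)
  where "c *\<^sub>c f = Bcontfun (\<lambda>x. c * apply_bcontfun f x)"

lemma apply_scaleC_bcontfun [simp]:
  "apply_bcontfun (c *\<^sub>c f) x = c * apply_bcontfun f x"
proof -
  have "bounded ((\<lambda>z. c * z) ` range (apply_bcontfun f))"
    by (intro bounded_linear_image bounded_linear_mult_right bounded_apply_bcontfun)
  then have "(\<lambda>x. c * apply_bcontfun f x) \<in> bcontfun"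
    by (auto simp: bcontfun_def image_image intro!: continuous_intros)
  then show ?thesis
    by (simp add: scaleC_bcontfun_def Bcontfun_inverse)
qed

definition norm_parallel ::
    "('a::topological_space \<Rightarrow>\<^sub>C complex) \<Rightarrow> ('a \<Rightarrow>\<^sub>C complex) \<Rightarrow> bool" (infix "\<parallel>" 50)
  where "f \<parallel> g \<longleftrightarrow> (\<exists>c::complex. cmod c = 1 \<and> norm (f + c *\<^sub>c g) = norm f + norm g)"

definition near_max_set :: "('a::topological_space \<Rightarrow>\<^sub>C complex) \<Rightarrow> real \<Rightarrow> 'a set"
  where "near_max_set f \<epsilon> = {x. cmod (apply_bcontfun f x) \<ge> norm f - \<epsilon>}"

lemma closed_near_max_set: "closed (near_max_set f \<epsilon>)"
  unfolding near_max_set_def by (intro closed_Collect_le continuous_intros) auto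

(* For sets M in the sigma-algebra of m only, e.g. closed M and Borel m: emeasure is 0 on
   sets that are not measurable. *)
definition concentrated_at :: "'a measure \<Rightarrow> 'a set \<Rightarrow> bool"
  where "concentrated_at m M \<longleftrightarrow> emeasure m (space m - M) = 0"

definition borel_prob_measure :: "'a::topological_space measure \<Rightarrow> bool"
  where "borel_prob_measure m \<longleftrightarrow> sets m = sets borel \<and> prob_space m"

end

theory Submission
  imports Defs
begin

text \<open>
  If \<open>f \<parallel> g\<close> with constant \<open>c\<close>, choose points \<open>x n\<close> at which \<open>cmod (f + c g)\<close> tends to
  \<open>norm f + norm g\<close>; there \<open>c * cnj f * g\<close> tends to \<open>norm f * norm g\<close>, and the point masses at
  \<open>x n\<close> serve as the measures for all \<open>\<epsilon>\<close> at once, after a shift of the index.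
  Conversely, \<open>cnj f * (f + c g)\<close> is bounded by \<open>norm f * norm (f + c g)\<close>; integrating, with \<open>c\<close>
  chosen to rotate the limit \<open>L1\<close> onto the positive axis, gives \<open>cmod L1 + L2 \<le> norm f * N\<close>, where
  \<open>N\<close> is the maximum of \<open>norm (f + c g)\<close> over the compact unit circle. Since \<open>L2 \<ge> (norm f - \<epsilon>)\<^sup>2\<close>,
  letting \<open>\<epsilon>\<close> tend to 0 yields \<open>norm f + norm g \<le> N\<close>.
\<close>

section \<open>Norms of \<open>f + c *\<^sub>c g\<close> for unimodular \<open>c\<close>\<close>

lemma norm_bcontfun_approx:
  fixes f :: "'a::topological_space \<Rightarrow>\<^sub>C 'b::real_normed_vector"
  assumes "0 < d"
  obtains x where "norm f - d < norm (apply_bcontfun f x)"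
proof -
  have "\<exists>x. norm f - d < norm (apply_bcontfun f x)"
  proof (rule ccontr)
    assume "\<nexists>x. norm f - d < norm (apply_bcontfun f x)"
    then have "norm f \<le> norm f - d"
      by (intro norm_bound) (simp add: not_less)
    with assms show False by simp
  qed
  then show thesis using that by blast
qed

lemma norm_scaleC_bcontfun_le: "norm (c *\<^sub>c f) \<le> cmod c * norm f"
  by (intro norm_bound) (simp add: norm_mult norm_bounded mult_left_mono)

lemma norm_add_scaleC_bcontfun_le:
  assumes "cmod c = 1"
  shows "norm (f + c *\<^sub>c g) \<le> norm f + norm g"
  using norm_triangle_ineq[of f "c *\<^sub>c g"] norm_scaleC_bcontfun_le[of c g] assms by simp

text \<open>The map from \<open>c\<close> to \<open>c *\<^sub>c g\<close> is Lipschitz with constant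
  \<open>norm g\<close>.\<close>

lemma continuous_on_norm_add_scaleC_bcontfun:
  "continuous_on S (\<lambda>c. norm (f + c *\<^sub>c g))"
proof (rule continuous_on_norm, rule continuous_on_add[OF continuous_on_const])
  have "dist (a *\<^sub>c g) (b *\<^sub>c g) \<le> norm g * dist a b" for a b
  proof -
    have "a *\<^sub>c g - b *\<^sub>c g = (a - b) *\<^sub>c g"
      by (rule bcontfun_eqI) (simp add: algebra_simps)
    then show ?thesis
      using norm_scaleC_bcontfun_le[of "a - b" g] by (simp add: dist_norm mult.commute)
  qed
  then have "(norm g)-lipschitz_on S (\<lambda>c. c *\<^sub>c g)"
    by (intro lipschitz_onI) auto
  then show "continuous_on S (\<lambda>c. c *\<^sub>c g)"
    by (rule lipschitz_on_continuous_on)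
qed

text \<open>Supplies one constant that serves every \<epsilon>. In the converse direction the
  rotating constant changes with \<epsilon>; bounding by the maximum avoids extracting a convergent
  subsequence of such constants.\<close>

lemma norm_add_scaleC_attains_max:
  obtains c where "cmod c = 1" "\<And>d. cmod d = 1 \<Longrightarrow> norm (f + d *\<^sub>c g) \<le> norm (f + c *\<^sub>c g)"
proof -
  have "\<exists>c\<in>sphere 0 1. \<forall>d\<in>sphere 0 1. norm (f + d *\<^sub>c g) \<le> norm (f + c *\<^sub>c g)"
    by (intro continuous_attains_sup continuous_on_norm_add_scaleC_bcontfun compact_sphere)
       (auto intro: exI[of _ 1])
  then show thesis using that by auto
qed

section \<open>Points that witness parallelism\<close>

lemma cmod_add_squared: "(cmod (a + b))\<^sup>2 = (cmod a)\<^sup>2 + (cmod b)\<^sup>2 + 2 * Re (cnj a * b)"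
  unfolding cmod_power2 by (simp add: power2_eq_square algebra_simps)

text \<open>Expanding the square and using \<open>cmod (z n) \<le> a\<close> bounds the squared
  distance from \<open>z n\<close> to \<open>a\<close> by \<open>2 * a * (a - Re (z n))\<close>, so
  the imaginary part has no room to survive.\<close>

lemma tendsto_of_Re_tendsto:
  fixes z :: "nat \<Rightarrow> complex"
  assumes "\<And>n. cmod (z n) \<le> a" and "(\<lambda>n. Re (z n)) \<longlonglongrightarrow> a"
  shows "z \<longlonglongrightarrow> of_real a"
proof -
  have le: "(cmod (z n - of_real a))\<^sup>2 \<le> 2 * a * (a - Re (z n))" for n
  proof -
    have "(cmod (z n))\<^sup>2 \<le> a\<^sup>2" using assms(1) by (intro power_mono) auto
    then show ?thesis
      using cmod_add_squared[of "z n" "- of_real a"] by (simp add: power2_eq_square algebra_simps)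
  qed
  have lim: "(\<lambda>n. 2 * a * (a - Re (z n))) \<longlonglongrightarrow> 0"
    using tendsto_mult[OF tendsto_const[of "2 * a"] tendsto_diff[OF tendsto_const[of a] assms(2)]]
    by simp
  have "(\<lambda>n. (cmod (z n - of_real a))\<^sup>2) \<longlonglongrightarrow> 0"
    by (rule tendsto_sandwich[OF _ _ tendsto_const lim]) (simp_all add: le)
  from tendsto_real_sqrt[OF this] have "(\<lambda>n. cmod (z n - of_real a)) \<longlonglongrightarrow> 0"
    by simp
  then show ?thesis
    by (simp add: tendsto_norm_zero_iff LIM_zero_iff)
qed

lemma bcontfun_measurable_borel [measurable]: "apply_bcontfun f \<in> borel_measurable borel"
  by (intro borel_measurable_continuous_onI continuous_on_apply_bcontfun continuous_on_id)

text \<open>Equality in the triangle inequality, reached in the limit, forces both moduli to their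
  maxima and aligns the arguments.\<close>

lemma norm_parallel_sequence:
  fixes f g :: "'a::topological_space \<Rightarrow>\<^sub>C complex"
  assumes "f \<parallel> g"
  obtains c x where "cmod c = 1"
    "(\<lambda>n::nat. cmod (apply_bcontfun f (x n))) \<longlonglongrightarrow> norm f"
    "(\<lambda>n. c * (cnj (apply_bcontfun f (x n)) * apply_bcontfun g (x n)))
       \<longlonglongrightarrow> of_real (norm f * norm g)"
proof -
  obtain c where c: "cmod c = 1" "norm (f + c *\<^sub>c g) = norm f + norm g"
    using assms unfolding norm_parallel_def by blast
  have "\<exists>x. \<forall>n. norm f + norm g - 1 / real (Suc n)
      < cmod (apply_bcontfun f (x n) + c * apply_bcontfun g (x n))"
  proof (rule choice, rule allI)
    fix n :: nat
    show "\<exists>x. norm f + norm g - 1 / real (Suc n)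
      < cmod (apply_bcontfun f x + c * apply_bcontfun g x)"
      using norm_bcontfun_approx[of "1 / real (Suc n)" "f + c *\<^sub>c g"] c(2) by fastforce
  qed
  then obtain x where x: "norm f + norm g - 1 / real (Suc n)
      < cmod (apply_bcontfun f (x n) + c * apply_bcontfun g (x n))" for n by blast
  \<comment> \<open>The unimodular \<open>c\<close> is absorbed into \<open>G\<close>, which keeps
    the bound \<open>norm g\<close>.\<close>
  define F G where "F n = apply_bcontfun f (x n)" and "G n = c * apply_bcontfun g (x n)" for n
  have FG: "norm f + norm g - 1 / real (Suc n) \<le> cmod (F n + G n)" for n
    using x[of n] by (simp add: F_def G_def)
  have F: "cmod (F n) \<le> norm f" and G: "cmod (G n) \<le> norm g" for n
    using norm_bounded[of f "x n"] norm_bounded[of g "x n"] c(1)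
    by (simp_all add: F_def G_def norm_mult)
  have squeeze: "u \<longlonglongrightarrow> a" if "\<And>n. a - 1 / real (Suc n) \<le> u n" "\<And>n. u n \<le> a"
    for u :: "nat \<Rightarrow> real" and a
  proof (rule tendsto_sandwich)
    show "(\<lambda>n. a - 1 / real (Suc n)) \<longlonglongrightarrow> a"
      using tendsto_diff[OF tendsto_const[of a] LIMSEQ_inverse_real_of_nat]
      by (simp add: inverse_eq_divide)
  qed (use that in auto)
  have tri: "cmod (F n + G n) \<le> cmod (F n) + cmod (G n)" for n
    by (rule norm_triangle_ineq)
  have lF: "(\<lambda>n. cmod (F n)) \<longlonglongrightarrow> norm f"
  proof (rule squeeze[OF _ F])
    show "norm f - 1 / real (Suc n) \<le> cmod (F n)" for n
      using FG[of n] tri[of n] G[of n] by linarith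
  qed
  have lG: "(\<lambda>n. cmod (G n)) \<longlonglongrightarrow> norm g"
  proof (rule squeeze[OF _ G])
    show "norm g - 1 / real (Suc n) \<le> cmod (G n)" for n
      using FG[of n] tri[of n] F[of n] by linarith
  qed
  have lFG: "(\<lambda>n. cmod (F n + G n)) \<longlonglongrightarrow> norm f + norm g"
  proof (rule squeeze[OF FG])
    show "cmod (F n + G n) \<le> norm f + norm g" for n
      using tri[of n] F[of n] G[of n] by linarith
  qed
  \<comment> \<open>Polarization: the quotient is \<open>Re (cnj (F n) * G n)\<close>, so its limit
    follows from the three limits of moduli.\<close>
  have "(\<lambda>n. ((cmod (F n + G n))\<^sup>2 - (cmod (F n))\<^sup>2 - (cmod (G n))\<^sup>2) / 2)
      \<longlonglongrightarrow> ((norm f + norm g)\<^sup>2 - (norm f)\<^sup>2 - (norm g)\<^sup>2) / 2"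
    by (intro tendsto_intros lF lG lFG) simp
  then have "(\<lambda>n. Re (cnj (F n) * G n)) \<longlonglongrightarrow> norm f * norm g"
    by (simp add: cmod_add_squared power2_sum del: times_complex.sel)
  then have "(\<lambda>n. cnj (F n) * G n) \<longlonglongrightarrow> of_real (norm f * norm g)"
    by (intro tendsto_of_Re_tendsto) (auto simp: norm_mult intro!: mult_mono F G)
  then show thesis
    using that[OF c(1), of x] lF by (simp add: F_def G_def mult_ac)
qed

section \<open>Point masses and integration against Borel probability measures\<close>

lemma borel_prob_measure_return: "borel_prob_measure (return borel x)"
  by (simp add: borel_prob_measure_def prob_space_return)

lemma concentrated_at_return:
  "M \<in> sets borel \<Longrightarrow> x \<in> M \<Longrightarrow> concentrated_at (return borel x) M"
  by (auto simp: concentrated_at_def emeasure_return borel_comp Compl_eq_Diff_UNIV[symmetric])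

text \<open>Closedness of the set matters here: its complement must be measurable, since
  \<open>emeasure\<close> is 0 on every non-measurable set and would then say nothing.\<close>

lemma AE_in_near_max_set:
  assumes "borel_prob_measure m" and "concentrated_at m (near_max_set f \<epsilon>)"
  shows "AE x in m. x \<in> near_max_set f \<epsilon>"
proof (rule AE_I)
  show "emeasure m (space m - near_max_set f \<epsilon>) = 0"
    using assms(2) by (simp add: concentrated_at_def)
  show "space m - near_max_set f \<epsilon> \<in> sets m"
    using assms(1) borel_closed[OF closed_near_max_set[of f \<epsilon>]]
    by (intro sets.compl_sets) (simp add: borel_prob_measure_def)
qed auto

lemma borel_prob_measure_integrable:
  fixes h :: "'a::topological_space \<Rightarrow> 'b::{banach, second_countable_topology}"
  assumes "borel_prob_measure m" and "h \<in> borel_measurable borel" and "\<And>x. norm (h x) \<le> B"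
  shows "integrable m h"
proof -
  interpret prob_space m using assms(1) by (simp add: borel_prob_measure_def)
  have "sets m = sets borel" using assms(1) by (simp add: borel_prob_measure_def)
  then have "h \<in> borel_measurable m"
    using assms(2) by (simp cong: measurable_cong_sets)
  then show ?thesis
    using assms(3) by (intro integrable_const_bound[of _ B]) auto
qed

lemma integrable_cnj_mult:
  assumes "borel_prob_measure m"
  shows "integrable m (\<lambda>x. cnj (apply_bcontfun f x) * apply_bcontfun g x)"
proof (rule borel_prob_measure_integrable[OF assms])
  show "(\<lambda>x. cnj (apply_bcontfun f x) * apply_bcontfun g x) \<in> borel_measurable borel"
    by (auto intro!: borel_measurable_continuous_onI continuous_intros)
  show "cmod (cnj (apply_bcontfun f x) * apply_bcontfun g x) \<le> norm f * norm g" for x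
    by (simp add: norm_mult norm_bounded mult_mono)
qed

lemma integrable_cmod_square:
  assumes "borel_prob_measure m"
  shows "integrable m (\<lambda>x. (cmod (apply_bcontfun f x))\<^sup>2)"
proof (rule borel_prob_measure_integrable[OF assms])
  show "(\<lambda>x. (cmod (apply_bcontfun f x))\<^sup>2) \<in> borel_measurable borel"
    by measurable
  show "norm ((cmod (apply_bcontfun f x))\<^sup>2) \<le> (norm f)\<^sup>2" for x
    by (simp add: norm_bounded power_mono)
qed

text \<open>Since \<open>cnj f * f\<close> is the squared modulus of \<open>f\<close>, the two
  integrands add up to the real part of \<open>cnj f * (f + c g)\<close>, which is bounded pointwise
  by the right-hand side; the total mass is 1.\<close>

lemma integral_inner_le:
  assumes m: "borel_prob_measure m"
  shows "Re (c * (\<integral>x. cnj (apply_bcontfun f x) * apply_bcontfun g x \<partial>m))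
           + (\<integral>x. (cmod (apply_bcontfun f x))\<^sup>2 \<partial>m)
         \<le> norm f * norm (f + c *\<^sub>c g)"
proof -
  interpret prob_space m using m by (simp add: borel_prob_measure_def)
  let ?h = "\<lambda>x. c * (cnj (apply_bcontfun f x) * apply_bcontfun g x)"
  let ?s = "\<lambda>x. (cmod (apply_bcontfun f x))\<^sup>2"
  note i = integrable_cnj_mult[OF m, of f g] integrable_cmod_square[OF m, of f]
  have ih: "integrable m ?h" using i(1) by (rule integrable_mult_right)
  have "Re (c * (\<integral>x. cnj (apply_bcontfun f x) * apply_bcontfun g x \<partial>m)) + (\<integral>x. ?s x \<partial>m)
      = (\<integral>x. Re (?h x) + ?s x \<partial>m)"
    by (simp only: Bochner_Integration.integral_add[OF integrable_Re[OF ih] i(2)]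
        integral_Re[OF ih] integral_mult_right_zero)
  also have "\<dots> \<le> (\<integral>x. norm f * norm (f + c *\<^sub>c g) \<partial>m)"
  proof (rule integral_mono)
    show "integrable m (\<lambda>x. Re (?h x) + ?s x)"
      using i(2) ih by (intro Bochner_Integration.integrable_add integrable_Re)
    fix x
    have "Re (?h x) + ?s x
        = Re (cnj (apply_bcontfun f x) * apply_bcontfun (f + c *\<^sub>c g) x)"
      unfolding cmod_power2 by (simp add: power2_eq_square algebra_simps)
    also have "\<dots> \<le> cmod (cnj (apply_bcontfun f x) * apply_bcontfun (f + c *\<^sub>c g) x)"
      by (rule complex_Re_le_cmod)
    also have "\<dots> \<le> norm f * norm (f + c *\<^sub>c g)"
      unfolding norm_mult complex_mod_cnj by (intro mult_mono norm_bounded) auto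
    finally show "Re (?h x) + ?s x \<le> norm f * norm (f + c *\<^sub>c g)" .
  qed simp
  also have "\<dots> = norm f * norm (f + c *\<^sub>c g)"
    by (simp add: prob_space)
  finally show ?thesis .
qed

lemma integral_cmod_square_ge:
  assumes m: "borel_prob_measure m" and con: "concentrated_at m (near_max_set f \<epsilon>)"
    and "\<epsilon> \<le> norm f"
  shows "(norm f - \<epsilon>)\<^sup>2 \<le> (\<integral>x. (cmod (apply_bcontfun f x))\<^sup>2 \<partial>m)"
proof -
  interpret prob_space m using m by (simp add: borel_prob_measure_def)
  have "(\<integral>x. (norm f - \<epsilon>)\<^sup>2 \<partial>m) \<le> (\<integral>x. (cmod (apply_bcontfun f x))\<^sup>2 \<partial>m)"
  proof (rule integral_mono_AE)
    show "AE x in m. (norm f - \<epsilon>)\<^sup>2 \<le> (cmod (apply_bcontfun f x))\<^sup>2"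
      using AE_in_near_max_set[OF m con]
      \<comment> \<open>\<open>\<epsilon> \<le> norm f\<close> makes the lower bound nonnegative, so
        that squaring preserves the inequality.\<close>
      by eventually_elim (use assms(3) in \<open>auto simp: near_max_set_def intro!: power_mono\<close>)
  qed (simp_all add: integrable_cmod_square[OF m])
  then show ?thesis by (simp add: prob_space)
qed

section \<open>From measures to parallelism\<close>

lemma exists_rotation: "\<exists>c. cmod c = 1 \<and> c * z = of_real (cmod z)"
proof (cases "z = 0")
  case False
  then show ?thesis
    by (intro exI[of _ "cnj z / of_real (cmod z)"])
       (simp add: norm_divide complex_norm_square[symmetric] mult.commute power2_eq_square)
qed (auto intro: exI[of _ 1])

lemma norm_parallel_if_measures:
  fixes f g :: "'a::topological_space \<Rightarrow>\<^sub>C complex"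
  assumes "\<And>\<epsilon>. \<epsilon> > 0 \<Longrightarrow> \<exists>(\<mu> :: nat \<Rightarrow> 'a measure) L1 L2.
      (\<forall>n. borel_prob_measure (\<mu> n) \<and> concentrated_at (\<mu> n) (near_max_set f \<epsilon>)) \<and>
      (\<lambda>n. \<integral>x. cnj (apply_bcontfun f x) * apply_bcontfun g x \<partial>(\<mu> n)) \<longlonglongrightarrow> L1 \<and>
      (\<lambda>n. \<integral>x. (cmod (apply_bcontfun f x))\<^sup>2 \<partial>(\<mu> n)) \<longlonglongrightarrow> L2 \<and>
      norm f * cmod L1 = norm g * L2"
  shows "f \<parallel> g"
proof -
  obtain c where c: "cmod c = 1" "\<And>d. cmod d = 1 \<Longrightarrow> norm (f + d *\<^sub>c g) \<le> norm (f + c *\<^sub>c g)"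
    using norm_add_scaleC_attains_max by blast
  have "norm f + norm g \<le> norm (f + c *\<^sub>c g)"
  \<comment> \<open>The main argument ends by cancelling \<open>(norm f)\<^sup>2\<close>; for
    \<open>f = 0\<close> the constant 1 already gives the bound.\<close>
  proof (cases "f = 0")
    case True
    have "1 *\<^sub>c g = g" by (rule bcontfun_eqI) simp
    then show ?thesis using c(2)[of 1] True by simp
  next
    case False
    then have pos: "norm f > 0" by simp
    have bound: "(norm f + norm g) * (norm f - \<epsilon>)\<^sup>2 \<le> (norm f)\<^sup>2 * norm (f + c *\<^sub>c g)"
      if \<epsilon>: "0 < \<epsilon>" "\<epsilon> < norm f" for \<epsilon>
    proof -
      obtain \<mu> L1 L2 where \<mu>: "borel_prob_measure (\<mu> n)"
          "concentrated_at (\<mu> n) (near_max_set f \<epsilon>)"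
        and L1: "(\<lambda>n. \<integral>x. cnj (apply_bcontfun f x) * apply_bcontfun g x \<partial>(\<mu> n)) \<longlonglongrightarrow> L1"
        and L2: "(\<lambda>n. \<integral>x. (cmod (apply_bcontfun f x))\<^sup>2 \<partial>(\<mu> n)) \<longlonglongrightarrow> L2"
        and eq: "norm f * cmod L1 = norm g * L2" for n :: nat
        using assms[OF \<epsilon>(1)] by blast
      obtain d where d: "cmod d = 1" "d * L1 = of_real (cmod L1)"
        using exists_rotation by blast
      \<comment> \<open>The pointwise estimate, integrated against each \<open>\<mu> n\<close>,
        passes to the limit.\<close>
      have "Re (d * L1) + L2 \<le> norm f * norm (f + d *\<^sub>c g)"
        by (rule LIMSEQ_le_const2[OF tendsto_add[OF tendsto_Re[OF tendsto_mult[OF tendsto_const L1]] L2]])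
           (use integral_inner_le \<mu> in blast)
      also have "\<dots> \<le> norm f * norm (f + c *\<^sub>c g)"
        using c(2)[OF d(1)] by (intro mult_left_mono) auto
      \<comment> \<open>The extra factor \<open>norm f\<close> lets the hypothesis replace
        \<open>norm f * cmod L1\<close> by \<open>norm g * L2\<close>, which turns the left side
        into a multiple of \<open>L2\<close>.\<close>
      finally have "norm f * (cmod L1 + L2) \<le> (norm f)\<^sup>2 * norm (f + c *\<^sub>c g)"
        using pos by (simp add: d(2) power2_eq_square mult.assoc)
      then have 1: "(norm f + norm g) * L2 \<le> (norm f)\<^sup>2 * norm (f + c *\<^sub>c g)"
        using eq by (simp add: algebra_simps)
      have "(norm f - \<epsilon>)\<^sup>2 \<le> L2"
        by (rule LIMSEQ_le_const[OF L2]) (use integral_cmod_square_ge[OF \<mu>] \<epsilon> in auto)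
      then have "(norm f + norm g) * (norm f - \<epsilon>)\<^sup>2 \<le> (norm f + norm g) * L2"
        by (intro mult_left_mono) auto
      with 1 show ?thesis by simp
    qed
    \<comment> \<open>The right side of \<open>bound\<close> is free of \<epsilon>, so the left side
      may go to its limit as \<epsilon> decreases to 0.\<close>
    have "((\<lambda>\<epsilon>. (norm f + norm g) * (norm f - \<epsilon>)\<^sup>2) \<longlongrightarrow> (norm f + norm g) * (norm f - 0)\<^sup>2) (at_right 0)"
      by (intro tendsto_intros)
    moreover have "\<forall>\<^sub>F \<epsilon> in at_right 0.
        (norm f + norm g) * (norm f - \<epsilon>)\<^sup>2 \<le> (norm f)\<^sup>2 * norm (f + c *\<^sub>c g)"
      using eventually_at_right_real[OF pos] by eventually_elim (use bound in auto)
    ultimately have "(norm f + norm g) * (norm f - 0)\<^sup>2 \<le> (norm f)\<^sup>2 * norm (f + c *\<^sub>c g)"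
      by (rule tendsto_upperbound) simp
    then show ?thesis using pos by (simp add: mult.commute)
  qed
  then show ?thesis
    unfolding norm_parallel_def
    using c(1) norm_add_scaleC_bcontfun_le[OF c(1), of f g] by (intro exI[of _ c]) auto
qed

theorem theorem2p3:
  fixes f g :: "'a::t2_space \<Rightarrow>\<^sub>C complex"
  assumes "locally_compact_space (euclidean :: 'a topology)"
  shows "(\<forall>\<epsilon>>0. \<exists>\<mu> :: nat \<Rightarrow> 'a measure.
            (\<forall>n. borel_prob_measure (\<mu> n) \<and> concentrated_at (\<mu> n) (near_max_set f \<epsilon>)) \<and>
            (\<exists>(L1::complex) (L2::real).
               (\<lambda>n. \<integral>x. cnj (apply_bcontfun f x) * apply_bcontfun g x \<partial>(\<mu> n)) \<longlonglongrightarrow> L1 \<and>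
               (\<lambda>n. \<integral>x. (cmod (apply_bcontfun f x))\<^sup>2 \<partial>(\<mu> n)) \<longlonglongrightarrow> L2 \<and>
               norm f * cmod L1 = norm g * L2))
         \<longleftrightarrow> f \<parallel> g"
    (is "?measures \<longleftrightarrow> _")
proof
  assume ?measures
  then show "f \<parallel> g"
    by (intro norm_parallel_if_measures) blast
next
  assume "f \<parallel> g"
  then obtain c x where c: "cmod c = 1"
    and lf: "(\<lambda>n::nat. cmod (apply_bcontfun f (x n))) \<longlonglongrightarrow> norm f"
    and lfg: "(\<lambda>n. c * (cnj (apply_bcontfun f (x n)) * apply_bcontfun g (x n)))
       \<longlonglongrightarrow> of_real (norm f * norm g)"
    by (rule norm_parallel_sequence)
  \<comment> \<open>Multiplying by \<open>cnj c\<close>, the inverse of \<open>c\<close>, undoes the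
    rotation.\<close>
  have "c * cnj c = 1" using c by (simp add: complex_norm_square[symmetric])
  then have lfg': "(\<lambda>n. cnj (apply_bcontfun f (x n)) * apply_bcontfun g (x n))
       \<longlonglongrightarrow> cnj c * of_real (norm f * norm g)"
    using tendsto_mult[OF tendsto_const[of "cnj c"] lfg]
    by (simp add: mult.assoc[symmetric] mult.commute[of "cnj c" c])
  show ?measures
  proof (intro allI impI)
    fix \<epsilon> :: real assume "\<epsilon> > 0"
    then have "\<forall>\<^sub>F n in sequentially. norm f - \<epsilon> < cmod (apply_bcontfun f (x n))"
      by (intro order_tendstoD(1)[OF lf]) simp
    then obtain k where k: "norm f - \<epsilon> < cmod (apply_bcontfun f (x n))" if "n \<ge> k" for n
      unfolding eventually_sequentially by blast
    \<comment> \<open>The shift by \<open>k\<close> puts every point, not just all late ones, in the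
      set for \<epsilon>.\<close>
    define \<mu> where "\<mu> n = return borel (x (n + k))" for n
    have "borel_prob_measure (\<mu> n) \<and> concentrated_at (\<mu> n) (near_max_set f \<epsilon>)" for n
      using k[of "n + k"] borel_closed[OF closed_near_max_set]
      by (auto simp: \<mu>_def near_max_set_def less_imp_le
          intro!: borel_prob_measure_return concentrated_at_return)
    moreover have "(\<integral>y. cnj (apply_bcontfun f y) * apply_bcontfun g y \<partial>(\<mu> n))
        = cnj (apply_bcontfun f (x (n + k))) * apply_bcontfun g (x (n + k))" for n
      unfolding \<mu>_def
      by (intro integral_return borel_measurable_continuous_onI continuous_intros) auto
    moreover have "(\<integral>y. (cmod (apply_bcontfun f y))\<^sup>2 \<partial>(\<mu> n))
        = (cmod (apply_bcontfun f (x (n + k))))\<^sup>2" for n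
      unfolding \<mu>_def by (intro integral_return) auto
    ultimately show "\<exists>\<mu> :: nat \<Rightarrow> 'a measure.
            (\<forall>n. borel_prob_measure (\<mu> n) \<and> concentrated_at (\<mu> n) (near_max_set f \<epsilon>)) \<and>
            (\<exists>(L1::complex) (L2::real).
               (\<lambda>n. \<integral>x. cnj (apply_bcontfun f x) * apply_bcontfun g x \<partial>(\<mu> n)) \<longlonglongrightarrow> L1 \<and>
               (\<lambda>n. \<integral>x. (cmod (apply_bcontfun f x))\<^sup>2 \<partial>(\<mu> n)) \<longlonglongrightarrow> L2 \<and>
               norm f * cmod L1 = norm g * L2)"
      \<comment> \<open>With these limits both sides of the required equality are
        \<open>(norm f)\<^sup>2 * norm g\<close>, because \<open>cnj c\<close> has modulus
        1.\<close>
      using LIMSEQ_ignore_initial_segment[OF lfg', of k]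
        LIMSEQ_ignore_initial_segment[OF tendsto_power[OF lf, of 2], of k] c
      by (intro exI[of _ \<mu>] conjI exI[of _ "cnj c * of_real (norm f * norm g)"]
            exI[of _ "(norm f)\<^sup>2"])
         (auto simp: norm_mult power2_eq_square)
  qed
qed

end
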